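(* Let $K\ge2$ be an integer, let $Z_1,\dots,Z_K$ be real random variables, and let $H(t)=\frac1K\sum_{k=1}^KF_k(t)$, where $F_k$ is the cumulative distribution function of $Z_k$. Let $H^{-1}(p)=\inf\{t:H(t)\ge p\}$ for $p\in(0,1)$ be the generalized inverse of $H$. Let $\varepsilon$ be uniformly distributed on $\{1,\dots,K\}$ and independent of $Z_k$, $k=1,\dots,K$, and let $U$ be uniformly distributed on $[0,1]$. Define $$Z=\sum_{k=1}^KZ_k\mathbf{1}_{\{\varepsilon=k\}}.$$ If $H$ is continuous, then $$H(Z)\overset{\mathcal{L}}{=}U\qquad\text{and}\qquad H^{-1}(U)\overset{\mathcal{L}}{=}Z,$$ where $\overset{\mathcal{L}}{=}$ denotes equality in distribution. *)

theory Defs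
  imports "HOL-Probability.Probability"
begin

definition avg_cdf :: "'a measure \<Rightarrow> nat \<Rightarrow> (nat \<Rightarrow> 'a \<Rightarrow> real) \<Rightarrow> real \<Rightarrow> real" where
  "avg_cdf M K Z t = (1 / real K) * (\<Sum>k=1..K. cdf (distr M borel (Z k)) t)"

text \<open>Only meaningful for \<open>0 < p < 1\<close> when \<open>H\<close> is a distribution function; at other
  arguments the infimum may be over an empty or unbounded set and is then unspecified.\<close>

definition gen_inverse :: "(real \<Rightarrow> real) \<Rightarrow> real \<Rightarrow> real" where
  "gen_inverse H p = Inf {t. H t \<ge> p}"

definition selected :: "nat \<Rightarrow> (nat \<Rightarrow> 'a \<Rightarrow> real) \<Rightarrow> ('a \<Rightarrow> nat) \<Rightarrow> 'a \<Rightarrow> real" where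
  "selected K Z \<epsilon> \<omega> = (\<Sum>k=1..K. Z k \<omega> * indicator {\<omega>'. \<epsilon> \<omega>' = k} \<omega>)"

text \<open>The two variables may live on different spaces. Measurability is part of the notion,
  since \<open>distr\<close> carries no information about a non-measurable function.\<close>

definition eq_in_law ::
  "'a measure \<Rightarrow> ('a \<Rightarrow> real) \<Rightarrow> 'b measure \<Rightarrow> ('b \<Rightarrow> real) \<Rightarrow> bool" where
  "eq_in_law M X N Y \<longleftrightarrow>
     X \<in> borel_measurable M \<and> Y \<in> borel_measurable N \<and> distr M borel X = distr N borel Y"

end

theory Submission
  imports Defs
begin

text \<open>
  Conditioning on \<open>\<epsilon>\<close> shows that \<open>Z\<close> has distribution function \<open>H\<close>. The law of \<open>H\<^sup>-\<^sup>1(U)\<close> is then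
  the quantile transform, and continuity of \<open>H\<close> gives \<open>H (H\<^sup>-\<^sup>1 u) = u\<close> on \<open>(0,1)\<close>, so that
  \<open>H(Z)\<close> has the law of \<open>H (H\<^sup>-\<^sup>1 U) = U\<close>.
\<close>

text \<open>The two domains differ by the endpoints 0 and 1, which are Lebesgue null, and
  \<open>{0..1}\<close> has length 1, so normalizing changes nothing. This links the law of
  \<open>U\<close> to \<open>distr_I_eq_M\<close>, which concerns the open interval.\<close>

lemma distr_uniform_unit_interval:
  fixes g :: "real \<Rightarrow> real"
  assumes [measurable]: "g \<in> borel_measurable borel"
  shows "distr (uniform_measure lborel {0..1::real}) borel g
       = distr (restrict_space lborel {0<..<1}) borel g"
proof (rule measure_eqI)
  show "sets (distr (uniform_measure lborel {0..1}) borel g)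
      = sets (distr (restrict_space lborel {0<..<1}) borel g)" by simp
  fix A assume "A \<in> sets (distr (uniform_measure lborel {0..1::real}) borel g)"
  then have [measurable]: "A \<in> sets borel" by simp
  have "{0..1} \<inter> g -` A \<in> sets borel" "{0<..<1} \<inter> g -` A \<in> sets borel"
    using measurable_sets[OF assms, of A] by auto
  moreover have "AE x in lborel. x \<in> {0..1} \<inter> g -` A \<longleftrightarrow> x \<in> {0<..<1} \<inter> g -` A"
    using AE_lborel_singleton[of 0] AE_lborel_singleton[of 1] by eventually_elim auto
  ultimately have "emeasure lborel ({0..1} \<inter> g -` A) = emeasure lborel ({0<..<1} \<inter> g -` A)"
    by (intro emeasure_eq_AE) auto
  moreover have "g \<in> borel_measurable (restrict_space lborel {0<..<1})"
    by (intro measurable_restrict_space1) auto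
  moreover have "emeasure (restrict_space lborel {0<..<1}) (g -` A \<inter> {0<..<1})
      = emeasure lborel (g -` A \<inter> {0<..<1})"
    by (rule emeasure_restrict_space) auto
  ultimately show "emeasure (distr (uniform_measure lborel {0..1}) borel g) A
      = emeasure (distr (restrict_space lborel {0<..<1}) borel g) A"
    using measurable_sets[OF assms, of A]
    by (simp add: emeasure_distr emeasure_uniform_measure space_restrict_space Int_commute
        divide_ennreal_def)
qed

context cdf_distribution
begin

text \<open>Off \<open>(0,1)\<close> the pseudoinverse is locally constant except at \<open>0\<close> and \<open>1\<close>, so the unspecified
  infima do not spoil measurability on the whole line.\<close>
lemma borel_measurable_gen_inverse: "gen_inverse C \<in> borel_measurable borel"
proof -
  have eq: "gen_inverse C = (\<lambda>p. if p \<in> {0<..<1} then I p else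
      if p \<le> 0 then Inf UNIV else if p = 1 then I 1 else Inf {})"
  proof
    fix p :: real
    \<comment> \<open>Since \<open>C\<close> takes values between 0 and 1, the superlevel set is the
      whole line for \<open>p \<le> 0\<close> and empty for \<open>p > 1\<close>. At
      \<open>p = 1\<close> either a nonempty or an empty set can occur, so \<open>I 1\<close> is
      kept as it stands.\<close>
    have "p \<le> C x" if "p \<le> 0" for x
      using that cdf_nonneg[of x] by linarith
    moreover have "\<not> p \<le> C x" if "p > 1" for x
      using that cdf_bounded_prob[of x] by linarith
    ultimately show "gen_inverse C p = (if p \<in> {0<..<1} then I p else
        if p \<le> 0 then Inf UNIV else if p = 1 then I 1 else Inf {})"
      by (simp add: gen_inverse_def)
  qed
  have "(\<lambda>p. if p \<in> {0<..<1} then I p else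
      if p \<le> 0 then Inf UNIV else if p = 1 then I 1 else Inf {}) \<in> borel_measurable borel"
    by (subst measurable_If_restrict_space_iff)
       (simp_all add: measurable_CI measurable_restrict_space1 del: greaterThanLessThan_iff)
  then show ?thesis unfolding eq .
qed

lemma distr_uniform_gen_inverse:
  "distr (uniform_measure lborel {0..1}) borel (gen_inverse C) = M"
  using distr_uniform_unit_interval[OF borel_measurable_gen_inverse] distr_I_eq_M
  by (simp add: gen_inverse_def[abs_def])

text \<open>An atom at the quantile would let \<open>C\<close> jump past \<open>u\<close> there.
  Continuity excludes this: \<open>C\<close> stays below \<open>u\<close> to the left of the
  quantile, and the left limit equals the value.\<close>

lemma cdf_gen_inverse:
  assumes cont: "isCont C (gen_inverse C u)" and u: "0 < u" "u < 1"
  shows "C (gen_inverse C u) = u"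
proof (rule antisym)
  let ?x = "gen_inverse C u"
  \<comment> \<open>Right-continuity of \<open>C\<close> makes the infimum attained, which gives an
    equivalence with non-strict inequalities on both sides.\<close>
  have Galois: "u \<le> C x \<longleftrightarrow> ?x \<le> x" for x
    using pseudoinverse[OF u, of x] by (simp add: gen_inverse_def)
  then show "u \<le> C ?x" by blast
  have "(C \<longlongrightarrow> C ?x) (at_left ?x)"
    using cont by (simp add: continuous_at filterlim_at_split)
  moreover have "\<forall>\<^sub>F x in at_left ?x. C x \<le> u"
    unfolding eventually_at_filter
    by (intro always_eventually) (metis Galois lessThan_iff nle_le not_le)
  ultimately show "C ?x \<le> u"
    by (rule tendsto_upperbound) simp
qed

text \<open>Representing \<open>M\<close> as the law of a quantile function under the uniform
  measure reduces the claim to the composition \<open>C \<circ> gen_inverse C\<close>, which is the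
  identity on the open unit interval.\<close>

lemma distr_cdf_eq_uniform:
  assumes cont: "continuous_on UNIV C"
  shows "distr M borel C = uniform_measure lborel {0..1}"
proof -
  note [measurable] = borel_measurable_gen_inverse
  have "distr M borel C
      = distr (distr (uniform_measure lborel {0..1}) borel (gen_inverse C)) borel C"
    by (simp add: distr_uniform_gen_inverse)
  also have "\<dots> = distr (uniform_measure lborel {0..1}) borel (C \<circ> gen_inverse C)"
    by (rule distr_distr) measurable
  \<comment> \<open>The endpoints must go before the cancellation, because
    \<open>cdf_gen_inverse\<close> holds only for \<open>0 < u < 1\<close>.\<close>
  also have "\<dots> = distr (restrict_space lborel {0<..<1}) borel (C \<circ> gen_inverse C)"
    by (rule distr_uniform_unit_interval) measurable
  also have "\<dots> = distr (restrict_space lborel {0<..<1}) borel (\<lambda>x. x)"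
    using cont by (intro distr_cong)
      (auto simp: space_restrict_space continuous_on_eq_continuous_at intro!: cdf_gen_inverse)
  also have "\<dots> = distr (uniform_measure lborel {0..1}) borel (\<lambda>x. x)"
    by (rule distr_uniform_unit_interval[symmetric]) measurable
  also have "\<dots> = uniform_measure lborel {0..1}"
    by (rule distr_id2) simp
  finally show ?thesis .
qed

end

lemma borel_measurable_selected:
  assumes Z: "\<And>k. k \<in> {1..K} \<Longrightarrow> Z k \<in> borel_measurable M"
    and [measurable]: "\<epsilon> \<in> measurable M (count_space UNIV)"
  shows "selected K Z \<epsilon> \<in> borel_measurable M"
proof -
  have "(\<lambda>\<omega>. Z k \<omega> * indicator {\<omega>'. \<epsilon> \<omega>' = k} \<omega>) \<in> borel_measurable M" if "k \<in> {1..K}" for k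
  proof -
    note [measurable] = Z[OF that]
    \<comment> \<open>The set inside the indicator is not cut down to \<open>space M\<close> and
      need not belong to \<open>sets M\<close>; the conditional form avoids it.\<close>
    have "(\<lambda>\<omega>. Z k \<omega> * (if \<epsilon> \<omega> = k then 1 else 0)) \<in> borel_measurable M"
      by measurable
    then show ?thesis by (simp add: indicator_def)
  qed
  then show ?thesis
    unfolding selected_def[abs_def] by (rule borel_measurable_sum)
qed

lemma selected_eq:
  assumes "\<epsilon> \<omega> \<in> {1..K}"
  shows "selected K Z \<epsilon> \<omega> = Z (\<epsilon> \<omega>) \<omega>"
proof -
  have "selected K Z \<epsilon> \<omega> = (\<Sum>k=1..K. if k = \<epsilon> \<omega> then Z k \<omega> else 0)"
    unfolding selected_def by (intro sum.cong) (auto simp: indicator_def)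
  then show ?thesis using assms by simp
qed

text \<open>Law of total probability: up to a null set, the event that the selected value is at most
  \<open>t\<close> is the disjoint union of the events \<open>B k\<close>, and independence of
  \<open>\<epsilon>\<close> from each single \<open>Z k\<close> factors their probabilities.\<close>

lemma (in prob_space) cdf_distr_selected:
  assumes K: "K \<ge> 1"
    and Z: "\<And>k. k \<in> {1..K} \<Longrightarrow> Z k \<in> borel_measurable M"
    and \<epsilon>[measurable]: "\<epsilon> \<in> measurable M (count_space UNIV)"
    and unif: "distr M (count_space UNIV) \<epsilon> = measure_pmf (pmf_of_set {1..K})"
    and indep: "\<And>k. k \<in> {1..K} \<Longrightarrow> indep_var borel (\<lambda>\<omega>. real (\<epsilon> \<omega>)) borel (Z k)"
  shows "cdf (distr M borel (selected K Z \<epsilon>)) = avg_cdf M K Z"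
proof
  fix t
  note [measurable] = borel_measurable_selected[OF Z \<epsilon>]
  define B where "B k = {\<omega> \<in> space M. \<epsilon> \<omega> = k \<and> Z k \<omega> \<le> t}" for k
  have B[measurable]: "B k \<in> sets M" if "k \<in> {1..K}" for k
    using Z[OF that] unfolding B_def by measurable
  have law_\<epsilon>: "prob (\<epsilon> -` A \<inter> space M) = measure_pmf.prob (pmf_of_set {1..K}) A" for A
    using measure_distr[OF \<epsilon>, of A] by (simp add: unif)
  have prob_B: "prob (B k) = 1 / K * cdf (distr M borel (Z k)) t" if k: "k \<in> {1..K}" for k
  proof -
    \<comment> \<open>Independence is assumed for the real-valued copy of \<open>\<epsilon>\<close>;
      injectivity of \<open>real\<close> turns its event back into \<open>\<epsilon> = k\<close>
      after the factorization.\<close>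
    have "B k = ((\<lambda>\<omega>. real (\<epsilon> \<omega>)) -` {real k} \<inter> space M) \<inter> (Z k -` {..t} \<inter> space M)"
      by (auto simp: B_def)
    also have "prob \<dots> = prob ((\<lambda>\<omega>. real (\<epsilon> \<omega>)) -` {real k} \<inter> space M) * prob (Z k -` {..t} \<inter> space M)"
      using indep_varD[OF indep[OF k], of "{real k}" "{..t}"]
      by (simp add: vimage_def Int_def conj_ac)
    also have "(\<lambda>\<omega>. real (\<epsilon> \<omega>)) -` {real k} \<inter> space M = \<epsilon> -` {k} \<inter> space M"
      by auto
    also have "prob \<dots> = 1 / K"
      using k by (simp add: law_\<epsilon> measure_pmf_single)
    also have "prob (Z k -` {..t} \<inter> space M) = cdf (distr M borel (Z k)) t"
      using Z[OF k] by (simp add: cdf_def measure_distr)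
    finally show ?thesis .
  qed
  \<comment> \<open>Only the law of \<open>\<epsilon>\<close> is prescribed, so its values lie in
    \<open>{1..K}\<close> almost everywhere; elsewhere \<open>selected\<close> is 0 and
    \<open>selected_eq\<close> does not apply.\<close>
  have "prob (\<epsilon> -` {1..K} \<inter> space M) = 1"
    using K by (simp add: law_\<epsilon> measure_pmf_of_set)
  then have range_\<epsilon>: "AE \<omega> in M. \<epsilon> \<omega> \<in> {1..K}"
    by (subst (asm) prob_eq_1) auto
  have "cdf (distr M borel (selected K Z \<epsilon>)) t = prob {\<omega> \<in> space M. selected K Z \<epsilon> \<omega> \<le> t}"
    by (simp add: cdf_def measure_distr vimage_def Int_def conj_ac)
  also have "\<dots> = prob (\<Union>k\<in>{1..K}. B k)"
  proof (rule finite_measure_eq_AE)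
    show "AE \<omega> in M. \<omega> \<in> {\<omega> \<in> space M. selected K Z \<epsilon> \<omega> \<le> t} \<longleftrightarrow> \<omega> \<in> (\<Union>k\<in>{1..K}. B k)"
      using range_\<epsilon> by eventually_elim (auto simp: B_def selected_eq)
  qed (use B in auto)
  also have "\<dots> = (\<Sum>k=1..K. prob (B k))"
    using B by (intro finite_measure_finite_Union) (auto simp: disjoint_family_on_def B_def)
  also have "\<dots> = avg_cdf M K Z t"
    using prob_B by (simp add: avg_cdf_def sum_distrib_left)
  finally show "cdf (distr M borel (selected K Z \<epsilon>)) t = avg_cdf M K Z t" .
qed

theorem lemma1:
  fixes M :: "'a measure" and N :: "'b measure"
    and K :: nat and Z :: "nat \<Rightarrow> 'a \<Rightarrow> real"
    and \<epsilon> :: "'a \<Rightarrow> nat" and U :: "'b \<Rightarrow> real"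
  assumes "prob_space M" and "prob_space N"
    and "K \<ge> 2"
    and "\<And>k. k \<in> {1..K} \<Longrightarrow> Z k \<in> borel_measurable M"
    and "\<epsilon> \<in> measurable M (count_space UNIV)"
    and "distr M (count_space UNIV) \<epsilon> = measure_pmf (pmf_of_set {1..K})"
    and "\<And>k. k \<in> {1..K} \<Longrightarrow> prob_space.indep_var M borel (\<lambda>\<omega>. real (\<epsilon> \<omega>)) borel (Z k)"
    and "U \<in> borel_measurable N"
    and "distr N borel U = uniform_measure lborel {0..1}"
    and "continuous_on UNIV (avg_cdf M K Z)"
  shows "eq_in_law M (\<lambda>\<omega>. avg_cdf M K Z (selected K Z \<epsilon> \<omega>)) N U \<and>
         eq_in_law N (\<lambda>\<omega>. gen_inverse (avg_cdf M K Z) (U \<omega>)) M (selected K Z \<epsilon>)"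
proof -
  let ?X = "selected K Z \<epsilon>" and ?H = "avg_cdf M K Z"
  interpret prob_space M by fact
  have X[measurable]: "?X \<in> borel_measurable M"
    using assms(4,5) by (rule borel_measurable_selected)
  have H: "cdf (distr M borel ?X) = ?H"
    using assms(3-7) by (intro cdf_distr_selected) auto
  \<comment> \<open>With \<open>C\<close> instantiated to the distribution function of
    \<open>?X\<close>, the equation \<open>H\<close> carries every fact about \<open>C\<close> over
    to \<open>?H\<close>.\<close>
  interpret X: cdf_distribution "distr M borel ?X"
    unfolding cdf_distribution_def using X by (rule real_distribution_distr)
  have H_meas[measurable]: "?H \<in> borel_measurable borel"
    using X.measurable_C by (simp add: H)
  have I_meas[measurable]: "gen_inverse ?H \<in> borel_measurable borel"
    using X.borel_measurable_gen_inverse by (simp add: H)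
  have "distr M borel (\<lambda>\<omega>. ?H (?X \<omega>)) = distr (distr M borel ?X) borel ?H"
    by (simp add: distr_distr comp_def)
  also have "\<dots> = distr N borel U"
    using X.distr_cdf_eq_uniform assms(9,10) by (simp add: H)
  finally have HX: "distr M borel (\<lambda>\<omega>. ?H (?X \<omega>)) = distr N borel U" .
  have "distr N borel (\<lambda>\<omega>. gen_inverse ?H (U \<omega>)) = distr (distr N borel U) borel (gen_inverse ?H)"
    using assms(8) by (simp add: distr_distr comp_def)
  also have "\<dots> = distr M borel ?X"
    using X.distr_uniform_gen_inverse by (simp add: H assms(9))
  finally have IU: "distr N borel (\<lambda>\<omega>. gen_inverse ?H (U \<omega>)) = distr M borel ?X" .
  show ?thesis
    unfolding eq_in_law_def using assms(8) HX IU by simp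
qed

end
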